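(* For online bin packing under the random-order model, the random-order ratio of Best-Fit satisfies $RR^\infty_{\mathrm{BF}}>1.144$.
   Context: Bin packing: an instance is a list $I=(x_1,\dots,x_n)$ of items with sizes in $(0,1]$, to be partitioned into the minimum number $\mathrm{Opt}(I)$ of unit-capacity bins (total size in each bin at most $1$). Best-Fit (BF) processes items in the given order and places each item into the fullest already-opened bin in which it fits, opening a new bin only if it fits nowhere; $\mathrm{BF}(J)$ is the number of bins used on sequence $J$. For a permutation $\sigma$ of $[n]$, $I_\sigma=(x_{\sigma(1)},\dots,x_{\sigma(n)})$. The random-order ratio of an online algorithm $\mathcal A$ is $RR^\infty_{\mathcal A}=\limsup_{m\to\infty}\sup_{I:\mathrm{Opt}(I)=m}\mathbb{E}_\sigma[\mathcal A(I_\sigma)]/\mathrm{Opt}(I)$, where $\sigma$ is uniform over all permutations of $[n]$. *)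

theory Defs
  imports "HOL-Probability.Probability" "HOL-Combinatorics.Permutations"
    "HOL-Library.Multiset"
begin

definition bp_instance :: "real list \<Rightarrow> bool" where
  "bp_instance I \<longleftrightarrow> (\<forall>x \<in> set I. 0 < x \<and> x \<le> 1)"

text \<open>A packing assigns to every item position \<open>i\<close> the index \<open>f i\<close> of its bin.\<close>

definition is_packing :: "real list \<Rightarrow> nat \<Rightarrow> (nat \<Rightarrow> nat) \<Rightarrow> bool" where
  "is_packing I k f \<longleftrightarrow>
     (\<forall>i < length I. f i < k) \<and>
     (\<forall>b < k. (\<Sum>i | i < length I \<and> f i = b. I ! i) \<le> 1)"

definition bp_opt :: "real list \<Rightarrow> nat" where
  "bp_opt I = (LEAST k. \<exists>f. is_packing I k f)"

text \<open>The state of Best-Fit is the multiset of the loads of the opened bins. Bins of equal load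
  are interchangeable for all later decisions, so no tie-breaking rule is needed.\<close>

definition best_fit_step :: "real \<Rightarrow> real multiset \<Rightarrow> real multiset" where
  "best_fit_step x B =
     (let F = {b. b \<in># B \<and> b + x \<le> 1}
      in if F = {} then add_mset x B
         else add_mset (Max F + x) (B - {#Max F#}))"

definition best_fit :: "real list \<Rightarrow> nat" where
  "best_fit J = size (fold best_fit_step J {#})"

text \<open>An online algorithm enters only through the number of bins that it uses on each sequence.\<close>

definition random_order_cost :: "(real list \<Rightarrow> nat) \<Rightarrow> real list \<Rightarrow> real" where
  "random_order_cost \<A> I =
     measure_pmf.expectation (pmf_of_set {\<sigma>. \<sigma> permutes {..<length I}})
       (\<lambda>\<sigma>. real (\<A> (permute_list \<sigma> I)))"

definition random_order_ratio :: "(real list \<Rightarrow> nat) \<Rightarrow> ereal" where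
  "random_order_ratio \<A> =
     limsup (\<lambda>m. SUP I \<in> {I. bp_instance I \<and> bp_opt I = m}.
       ereal (random_order_cost \<A> I / real (bp_opt I)))"

end

theory Submission
  imports Defs
begin

text \<open>
  Take thirteen items that fill four bins exactly: in units of \<open>1/120\<close>, the bins \<open>30,30,30,30\<close>,
  \<open>31,31,58\<close>, \<open>33,33,54\<close> and \<open>37,37,46\<close>. Draw \<open>n\<close> items independently and uniformly from these
  thirteen. Such a sequence is invariant in distribution under permutations, and with high probability
  it packs into \<open>4n/13 + o(n)\<close> bins. Under Best-Fit the bins that can still receive an item form a
  Markov chain with 240 states, whose long-run rate of opened bins exceeds \<open>1.144 \<cdot> 4/13\<close> per item.
  The rate is bounded from below by a potential \<open>h\<close> on the states: in every state, the expected number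
  of opened bins plus the expected increase of \<open>h\<close> is at least the claimed rate.
\<close>

section \<open>Independent sequences and the random-order ratio\<close>

text \<open>Independent uniform labels are handled by counting: the expectation of a function of
  \<open>n\<close> labels is its sum over \<open>words W n\<close> divided by \<open>W ^ n\<close>.
  All later bounds are kept in this unnormalised form.\<close>

definition words :: "nat \<Rightarrow> nat \<Rightarrow> nat list set" where
  "words W n = {ls. set ls \<subseteq> {..<W} \<and> length ls = n}"

lemma finite_words [simp]: "finite (words W n)"
  unfolding words_def by (rule finite_lists_length_eq) simp

lemma card_words: "card (words W n) = W ^ n"
  unfolding words_def by (simp add: card_lists_length_eq)

lemma words_0: "words W 0 = {[]}"
  by (auto simp: words_def)

text \<open>The new letter is appended at the end because an online algorithm reads from the front,
  so the last letter is the newest item.\<close>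

lemma sum_words_Suc:
  fixes f :: "nat list \<Rightarrow> 'a::comm_monoid_add"
  shows "(\<Sum>ls\<in>words W (Suc n). f ls) = (\<Sum>ls\<in>words W n. \<Sum>i<W. f (ls @ [i]))"
proof -
  have "(\<Sum>ls\<in>words W n. \<Sum>i<W. f (ls @ [i])) = (\<Sum>(ls, i)\<in>words W n \<times> {..<W}. f (ls @ [i]))"
    by (simp add: sum.cartesian_product)
  also have "\<dots> = (\<Sum>ls\<in>words W (Suc n). f ls)"
  proof (rule sum.reindex_bij_witness[where i = "\<lambda>ls. (butlast ls, last ls)" and j = "\<lambda>(ls, i). ls @ [i]"])
    fix ls assume ls: "ls \<in> words W (Suc n)"
    then have ne: "ls \<noteq> []" by (auto simp: words_def)
    show "(case (butlast ls, last ls) of (ls, i) \<Rightarrow> ls @ [i]) = ls" using ne by simp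
    have "last ls \<in> set ls" using ne by simp
    then show "(butlast ls, last ls) \<in> words W n \<times> {..<W}"
      using ls by (auto simp: words_def dest: in_set_butlastD)
  qed (auto simp: words_def)
  finally show ?thesis ..
qed

lemma permute_list_in_words:
  assumes "\<sigma> permutes {..<n}" "ls \<in> words W n"
  shows "permute_list \<sigma> ls \<in> words W n"
  using assms by (auto simp: words_def set_permute_list)

lemma sum_words_permute:
  fixes f :: "nat list \<Rightarrow> 'a::comm_monoid_add"
  assumes \<sigma>: "\<sigma> permutes {..<n}"
  shows "(\<Sum>ls\<in>words W n. f (permute_list \<sigma> ls)) = (\<Sum>ls\<in>words W n. f ls)"
proof (rule sum.reindex_bij_witness[where i = "permute_list (inv \<sigma>)" and j = "permute_list \<sigma>"])
  have inv: "inv \<sigma> permutes {..<n}" using \<sigma> by (rule permutes_inv)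
  fix ls assume ls: "ls \<in> words W n"
  then have len: "length ls = n" by (simp add: words_def)
  show "permute_list (inv \<sigma>) (permute_list \<sigma> ls) = ls"
    using permute_list_compose[of "inv \<sigma>" ls \<sigma>] inv len permutes_inv_o(1)[OF \<sigma>]
    by (simp add: permute_list_id)
  show "permute_list \<sigma> (permute_list (inv \<sigma>) ls) = ls"
    using permute_list_compose[of \<sigma> ls "inv \<sigma>"] \<sigma> len permutes_inv_o(2)[OF \<sigma>]
    by (simp add: permute_list_id)
  show "permute_list \<sigma> ls \<in> words W n" "permute_list (inv \<sigma>) ls \<in> words W n"
    using \<sigma> inv ls by (auto intro: permute_list_in_words)
qed simp

section \<open>Averaging the random-order cost over words\<close>

lemma random_order_cost_eq:
  "random_order_cost A I =
     (\<Sum>\<sigma> | \<sigma> permutes {..<length I}. real (A (permute_list \<sigma> I))) / fact (length I)"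
proof -
  let ?P = "{\<sigma>. \<sigma> permutes {..<length I}}"
  have "finite ?P" by (simp add: finite_permutations)
  moreover have "?P \<noteq> {}" using permutes_id by blast
  ultimately show ?thesis
    unfolding random_order_cost_def by (simp add: integral_pmf_of_set card_permutations)
qed

text \<open>After exchanging the sums over words and permutations, each permutation contributes the
  same amount, since it only rearranges the set of words.\<close>

lemma sum_words_random_order_cost:
  "(\<Sum>ls\<in>words W n. random_order_cost A (map h ls)) = (\<Sum>ls\<in>words W n. real (A (map h ls)))"
proof -
  let ?P = "{\<sigma>. \<sigma> permutes {..<n}}"
  have "(\<Sum>ls\<in>words W n. random_order_cost A (map h ls)) =
      (\<Sum>ls\<in>words W n. (\<Sum>\<sigma>\<in>?P. real (A (map h (permute_list \<sigma> ls)))) / fact n)"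
    by (intro sum.cong) (auto simp: random_order_cost_eq words_def permute_list_map)
  also have "\<dots> = (\<Sum>\<sigma>\<in>?P. \<Sum>ls\<in>words W n. real (A (map h (permute_list \<sigma> ls)))) / fact n"
    by (subst sum.swap) (simp add: sum_divide_distrib)
  also have "(\<Sum>\<sigma>\<in>?P. \<Sum>ls\<in>words W n. real (A (map h (permute_list \<sigma> ls)))) =
      (\<Sum>\<sigma>\<in>?P. \<Sum>ls\<in>words W n. real (A (map h ls)))"
    by (intro sum.cong refl sum_words_permute[where f = "\<lambda>ls. real (A (map h ls))"]) simp
  also have "\<dots> = fact n * (\<Sum>ls\<in>words W n. real (A (map h ls)))"
    by (simp add: card_permutations)
  finally show ?thesis by simp
qed

text \<open>A variance bound: each letter adds a centred increment \<open>d j\<close> of square at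
  most 1, and the cross terms cancel because the increments sum to 0.\<close>

lemma sum_words_count_deviation:
  assumes "i < W"
  shows "(\<Sum>ls\<in>words W n. (real (count_list ls i) - real n / real W)\<^sup>2) \<le> real n * real W ^ n"
proof (induction n)
  case 0
  then show ?case by (simp add: words_0)
next
  case (Suc n)
  define d where "d j = (if j = i then 1 else 0) - 1 / real W" for j
  have W: "real W > 0" using assms by simp
  have d1: "(\<Sum>j<W. d j) = 0"
    using assms W by (simp add: d_def sum_subtractf)
  have "(d j)\<^sup>2 \<le> 1" for j
  proof -
    have "\<bar>d j\<bar> \<le> 1" using assms by (auto simp: d_def abs_le_iff field_simps)
    then show ?thesis by (simp add: abs_square_le_1)
  qed
  then have d2: "(\<Sum>j<W. (d j)\<^sup>2) \<le> real W"
    using sum_mono[of "{..<W}" "\<lambda>j. (d j)\<^sup>2" "\<lambda>_. 1"] by simp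
  let ?x = "\<lambda>ls. real (count_list ls i) - real n / real W"
  have split: "real (count_list (ls @ [j]) i) - real (Suc n) / real W = ?x ls + d j" for ls j
    by (simp add: d_def add_divide_distrib)
  have step: "(\<Sum>j<W. (?x ls + d j)\<^sup>2) \<le> real W * (?x ls)\<^sup>2 + real W" for ls
  proof -
    have "(\<Sum>j<W. (?x ls + d j)\<^sup>2) = real W * (?x ls)\<^sup>2 + 2 * ?x ls * (\<Sum>j<W. d j) + (\<Sum>j<W. (d j)\<^sup>2)"
      by (simp add: power2_sum sum.distrib sum_distrib_left mult.assoc)
    then show ?thesis using d1 d2 by simp
  qed
  have "(\<Sum>ls\<in>words W (Suc n). (real (count_list ls i) - real (Suc n) / real W)\<^sup>2) =
      (\<Sum>ls\<in>words W n. \<Sum>j<W. (?x ls + d j)\<^sup>2)"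
    by (simp only: sum_words_Suc split)
  also have "\<dots> \<le> (\<Sum>ls\<in>words W n. real W * (?x ls)\<^sup>2 + real W)"
    by (intro sum_mono step)
  also have "\<dots> = real W * (\<Sum>ls\<in>words W n. (?x ls)\<^sup>2) + real W ^ n * real W"
    by (simp add: sum.distrib sum_distrib_left card_words)
  also have "\<dots> \<le> real W * (real n * real W ^ n) + real W ^ n * real W"
    using Suc.IH W by (intro add_right_mono mult_left_mono) auto
  finally show ?case by (simp add: algebra_simps)
qed

section \<open>Bounds on the optimum\<close>

lemma bp_opt_le: "is_packing I k f \<Longrightarrow> bp_opt I \<le> k"
  unfolding bp_opt_def by (rule Least_le) blast

text \<open>One bin per item is a packing, so the \<open>LEAST\<close> in \<open>bp_opt\<close> is
  attained.\<close>

lemma bp_opt_packing: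
  assumes "bp_instance I"
  obtains f where "is_packing I (bp_opt I) f"
proof -
  have "{i. i < length I \<and> i = b} = {b}" if "b < length I" for b using that by auto
  then have "is_packing I (length I) (\<lambda>i. i)"
    using assms by (auto simp: is_packing_def bp_instance_def)
  then have "\<exists>f. is_packing I (bp_opt I) f"
    unfolding bp_opt_def using LeastI_ex[of "\<lambda>k. \<exists>f. is_packing I k f"] by blast
  then show thesis using that by blast
qed

lemma sum_list_le_bp_opt:
  assumes "bp_instance I"
  shows "sum_list I \<le> real (bp_opt I)"
proof -
  obtain f where f: "is_packing I (bp_opt I) f" using assms by (rule bp_opt_packing)
  have "sum_list I = (\<Sum>i<length I. I ! i)" by (simp add: sum_list_sum_nth atLeast0LessThan)
  also have "\<dots> = (\<Sum>b<bp_opt I. \<Sum>i | i \<in> {..<length I} \<and> f i = b. I ! i)"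
    using f by (intro sum.group[symmetric]) (auto simp: is_packing_def)
  also have "\<dots> \<le> (\<Sum>b<bp_opt I. 1)"
    using f by (intro sum_mono) (auto simp: is_packing_def)
  finally show ?thesis by simp
qed

lemma count_list_take_less:
  assumes "k < k'" "k' \<le> length ls"
  shows "count_list (take k ls) (ls ! k) < count_list (take k' ls) (ls ! k)"
proof -
  have "take k' ls = take k ls @ ls ! k # drop (Suc k) (take k' ls)"
    using id_take_nth_drop[of k "take k' ls"] assms by (simp add: min_def)
  from arg_cong[OF this, of "\<lambda>xs. count_list xs (ls ! k)"] show ?thesis by simp
qed

text \<open>The \<open>j\<close>-th occurrences of all the labels together form a subset of one copy of the template.\<close>

lemma bp_opt_word_le:
  assumes T: "bp_instance T" and g: "is_packing T Q g"
    and ls: "ls \<in> words (length T) n" and M: "\<And>i. i < length T \<Longrightarrow> count_list ls i \<le> M"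
  shows "bp_opt (map ((!) T) ls) \<le> Q * M"
proof (rule bp_opt_le)
  \<comment> \<open>The pair of occurrence number (from 0) and template bin is encoded in base
    \<open>Q\<close>; \<open>div\<close> and \<open>mod\<close> recover its components.\<close>
  define f where "f k = count_list (take k ls) (ls ! k) * Q + g (ls ! k)" for k
  have len: "length ls = n" and label: "\<And>k. k < n \<Longrightarrow> ls ! k < length T"
    using ls by (auto simp: words_def subset_iff)
  have gQ: "g (ls ! k) < Q" if "k < n" for k using g label[OF that] by (simp add: is_packing_def)
  show "is_packing (map ((!) T) ls) (Q * M) f"
    unfolding is_packing_def length_map len
  proof (intro conjI allI impI)
    fix k assume k: "k < n"
    have "count_list (take k ls) (ls ! k) < M"
      using count_list_take_less[of k n ls] k len M[OF label[OF k]] by simp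
    then have "Suc (count_list (take k ls) (ls ! k)) * Q \<le> M * Q" by (intro mult_le_mono1) simp
    then show "f k < Q * M" using gQ[OF k] by (simp add: f_def mult.commute)
  next
    fix b assume "b < Q * M"
    let ?K = "{k. k < n \<and> f k = b}"
    have f_div: "f k div Q = count_list (take k ls) (ls ! k)" and f_mod: "f k mod Q = g (ls ! k)"
      if "k < n" for k using gQ[OF that] by (simp_all add: f_def)
    \<comment> \<open>Positions sharing a bin have the same occurrence number, so they carry
      distinct labels.\<close>
    have less: "ls ! k \<noteq> ls ! k'" if "k \<in> ?K" "k' \<in> ?K" "k < k'" for k k'
      using count_list_take_less[of k k' ls] f_div[of k] f_div[of k'] that len by auto
    have inj: "inj_on ((!) ls) ?K"
    proof (rule inj_onI)
      fix k k' assume "k \<in> ?K" "k' \<in> ?K" "ls ! k = ls ! k'"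
      then show "k = k'" using less[of k k'] less[of k' k] by (cases k k' rule: linorder_cases) auto
    qed
    have "(\<Sum>k\<in>?K. map ((!) T) ls ! k) = (\<Sum>k\<in>?K. T ! (ls ! k))"
      using len by (intro sum.cong) auto
    also have "\<dots> = (\<Sum>i\<in>(!) ls ` ?K. T ! i)" using inj by (simp add: sum.reindex)
    also have "\<dots> \<le> (\<Sum>i | i < length T \<and> g i = b mod Q. T ! i)"
      using T label f_mod by (intro sum_mono2) (auto simp: bp_instance_def intro: less_imp_le)
    also have "\<dots> \<le> 1"
    proof -
      have "Q > 0" using \<open>b < Q * M\<close> by (cases Q) auto
      then show ?thesis using g by (simp add: is_packing_def)
    qed
    finally show "(\<Sum>k | k < n \<and> f k = b. map ((!) T) ls ! k) \<le> 1" .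
  qed
qed

text \<open>The optimum is at most \<open>Q\<close> times the largest label count. The excess of
  that count over \<open>n / W\<close> is controlled by second moments; the free parameter
  \<open>e\<close> makes the linear error \<open>e * n\<close> as small as desired at the price of a
  constant.\<close>

lemma sum_words_bp_opt_le:
  assumes T: "bp_instance T" "T \<noteq> []" and g: "is_packing T Q g" and e: "e > 0"
  defines "W \<equiv> length T"
  shows "(\<Sum>ls\<in>words W n. real (bp_opt (map ((!) T) ls))) \<le>
    real W ^ n * (real Q * (real n / W + W * (e * n + 1 / e)))"
proof -
  have W: "W > 0" using T by (simp add: W_def)
  define x where "x ls i = real (count_list (ls :: nat list) i) - real n / real W" for ls i
  have abs_le: "y \<le> e * y\<^sup>2 + 1 / e" for y :: real
  proof -
    have "0 \<le> (e * y - 1)\<^sup>2" by simp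
    then have "e * (2 * y) \<le> e * (e * y\<^sup>2 + 1 / e)"
      using e by (simp add: power2_diff algebra_simps power2_eq_square)
    then have "2 * y \<le> e * y\<^sup>2 + 1 / e" using e by simp
    moreover have "0 \<le> e * y\<^sup>2 + 1 / e" using e by simp
    ultimately show ?thesis by linarith
  qed
  have "real (bp_opt (map ((!) T) ls)) \<le> Q * (real n / W + (\<Sum>i<W. e * (x ls i)\<^sup>2 + 1 / e))"
    if ls: "ls \<in> words W n" for ls
  proof -
    define M where "M = Max (count_list ls ` {..<W})"
    have "M \<in> count_list ls ` {..<W}" unfolding M_def using W by (intro Max_in) auto
    then obtain i where i: "i < W" "M = count_list ls i" by auto
    have "count_list ls i \<le> M" if "i < W" for i unfolding M_def using that by (intro Max_ge) auto
    then have "bp_opt (map ((!) T) ls) \<le> Q * M"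
      using bp_opt_word_le[OF T(1) g] ls by (simp add: W_def)
    then have "real (bp_opt (map ((!) T) ls)) \<le> real (Q * M)" by (simp only: of_nat_le_iff)
    also have "\<dots> = Q * (real n / W + x ls i)" by (simp add: x_def i)
    also have "x ls i \<le> e * (x ls i)\<^sup>2 + 1 / e" by (rule abs_le)
    \<comment> \<open>The most frequent label depends on the word; summing over all labels removes
      this dependence, so that the sums can be exchanged.\<close>
    also have "\<dots> \<le> (\<Sum>i<W. e * (x ls i)\<^sup>2 + 1 / e)"
      using e i by (intro member_le_sum) auto
    finally show ?thesis by (simp add: mult_left_mono)
  qed
  then have "(\<Sum>ls\<in>words W n. real (bp_opt (map ((!) T) ls))) \<le>
      (\<Sum>ls\<in>words W n. Q * (real n / W + (\<Sum>i<W. e * (x ls i)\<^sup>2 + 1 / e)))"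
    by (rule sum_mono)
  also have "\<dots> = Q * (W ^ n * (real n / W) + (\<Sum>i<W. e * (\<Sum>ls\<in>words W n. (x ls i)\<^sup>2) + W ^ n * (1 / e)))"
    using sum.swap[of "\<lambda>ls i. (x ls i)\<^sup>2" "{..<W}" "words W n"]
    by (simp add: sum.distrib card_words flip: sum_distrib_left)
  also have "\<dots> \<le> Q * (W ^ n * (real n / W) + (\<Sum>i<W. e * (real n * real W ^ n) + W ^ n * (1 / e)))"
    using e sum_words_count_deviation[of _ W n]
    by (intro mult_left_mono add_left_mono add_right_mono sum_mono) (auto simp: x_def)
  also have "\<dots> = real W ^ n * (real Q * (real n / W + W * (e * n + 1 / e)))"
    by (simp add: algebra_simps)
  finally show ?thesis .
qed

text \<open>Permuting a sequence of independent uniform labels does not change its distribution, so the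
  average cost over such sequences is an average of random-order costs, while almost all of them
  consist of nearly equally many copies of every template item.\<close>

lemma random_order_ratio_gt_template:
  assumes T: "bp_instance T" "T \<noteq> []" and g: "is_packing T Q g" and Q: "Q > 0"
    and A: "\<And>n. real (length T) ^ n * (c * real n) \<le>
      (\<Sum>ls\<in>words (length T) n. real (A (map ((!) T) ls)))"
    and r: "0 \<le> r" "r < c * real (length T) / real Q"
  shows "random_order_ratio A > ereal r"
proof (rule ccontr)
  define W where "W = length T"
  have W: "real W > 0" using T by (simp add: W_def)
  assume "\<not> random_order_ratio A > ereal r"
  \<comment> \<open>A value strictly above \<open>r\<close> turns the bound on the limsup into a
    bound valid for all large \<open>m\<close>.\<close>
  moreover obtain r' where r': "r < r'" "r' < c * real W / real Q"
    using dense[OF r(2)] by (auto simp: W_def)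
  ultimately have "random_order_ratio A < ereal r'"
    using le_less_trans[of _ "ereal r" "ereal r'"] by (simp add: not_less)
  then have "\<forall>\<^sub>F m in sequentially.
      (SUP I \<in> {I. bp_instance I \<and> bp_opt I = m}. ereal (random_order_cost A I / real (bp_opt I))) < ereal r'"
    unfolding random_order_ratio_def by (rule Limsup_lessD)
  then obtain m0 where m0: "\<And>m. m \<ge> m0 \<Longrightarrow>
      (SUP I \<in> {I. bp_instance I \<and> bp_opt I = m}. ereal (random_order_cost A I / real (bp_opt I))) < ereal r'"
    by (auto simp: eventually_sequentially)
  have cost: "random_order_cost A I \<le> r' * real (bp_opt I)"
    if "bp_instance I" "bp_opt I \<ge> m0" "bp_opt I > 0" for I
  proof -
    have "ereal (random_order_cost A I / real (bp_opt I)) < ereal r'"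
      using that by (intro le_less_trans[OF SUP_upper m0[of "bp_opt I"]]) auto
    then show ?thesis using that by (simp add: pos_divide_less_eq)
  qed
  \<comment> \<open>With the smallest item size \<open>\<delta>\<close>, every word of length
    \<open>n\<close> has total size at least \<open>\<delta> * n\<close>. Hence all long words,
    however unbalanced, have an optimum beyond \<open>m0\<close>.\<close>
  define \<delta> where "\<delta> = Min (set T)"
  have \<delta>: "\<delta> > 0" "\<And>i. i < W \<Longrightarrow> \<delta> \<le> T ! i"
    using T by (auto simp: \<delta>_def bp_instance_def W_def)
  have opt_ge: "\<delta> * real n \<le> real (bp_opt (map ((!) T) ls))" and inst: "bp_instance (map ((!) T) ls)"
    if "ls \<in> words W n" for ls n
  proof -
    show inst: "bp_instance (map ((!) T) ls)"
      using that T by (auto simp: bp_instance_def words_def W_def subset_iff)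
    have "\<delta> * real n = (\<Sum>i\<leftarrow>ls. \<delta>)" using that by (simp add: words_def sum_list_triv)
    also have "\<dots> \<le> (\<Sum>i\<leftarrow>ls. T ! i)" using that \<delta>(2) by (intro sum_list_mono) (auto simp: words_def)
    also have "\<dots> \<le> real (bp_opt (map ((!) T) ls))" using sum_list_le_bp_opt[OF inst] by simp
    finally show "\<delta> * real n \<le> real (bp_opt (map ((!) T) ls))" .
  qed
  have r'_pos: "r' > 0" using r r' by linarith
  \<comment> \<open>Chosen so that the linear error \<open>r' * Q * W * e\<close> uses up exactly
    half of the gap \<open>c - r' * Q / W\<close>.\<close>
  define e where "e = (c - r' * Q / W) / (2 * r' * Q * W)"
  have gap: "c - r' * Q / W > 0" using r' Q W by (simp add: field_simps)
  then have e: "e > 0" using r'_pos Q W by (simp add: e_def)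
  have half: "(a - k) / 2 * x \<le> b" if "a * x \<le> k * x + (a - k) / 2 * x + b" for a x k b :: real
    using that by (simp add: field_simps)
  have bound: "(c - r' * Q / W) / 2 * real n \<le> r' * Q * W / e"
    if n: "real m0 + 1 \<le> \<delta> * real n" for n
  proof -
    have "real W ^ n * (c * real n) \<le> (\<Sum>ls\<in>words W n. random_order_cost A (map ((!) T) ls))"
      using A[of n] by (simp add: sum_words_random_order_cost W_def)
    also have "\<dots> \<le> (\<Sum>ls\<in>words W n. r' * real (bp_opt (map ((!) T) ls)))"
    proof (intro sum_mono cost)
      fix ls assume ls: "ls \<in> words W n"
      show "bp_instance (map ((!) T) ls)" using ls by (rule inst)
      have "real m0 + 1 \<le> real (bp_opt (map ((!) T) ls))" using opt_ge[OF ls] n by linarith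
      then show "m0 \<le> bp_opt (map ((!) T) ls)" "0 < bp_opt (map ((!) T) ls)" by linarith+
    qed
    also have "\<dots> = r' * (\<Sum>ls\<in>words W n. real (bp_opt (map ((!) T) ls)))"
      by (simp add: sum_distrib_left)
    also have "\<dots> \<le> r' * (real W ^ n * (real Q * (real n / W + W * (e * n + 1 / e))))"
      using sum_words_bp_opt_le[OF T g e, of n] r'_pos by (intro mult_left_mono) (auto simp: W_def)
    also have "\<dots> = real W ^ n * (r' * (real Q * (real n / W + W * (e * n + 1 / e))))"
      by (simp add: mult.left_commute)
    finally have "c * real n \<le> r' * (real Q * (real n / W + W * (e * n + 1 / e)))"
      using W by simp
    also have "\<dots> = (r' * Q / W) * n + (r' * Q * W * e) * n + r' * Q * W / e"
      by (simp add: algebra_simps)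
    also have "r' * Q * W * e = (c - r' * Q / W) / 2"
      using r'_pos Q W by (simp add: e_def)
    finally show ?thesis
      using half[of c "real n" "r' * Q / W" "r' * Q * W / e"] by simp
  qed
  \<comment> \<open>\<open>n1\<close> makes words long enough for \<open>bound\<close>;
    \<open>n2\<close> exceeds every length that \<open>bound\<close> allows.\<close>
  obtain n1 :: nat where n1: "(real m0 + 1) / \<delta> \<le> real n1" using real_arch_simple by blast
  obtain n2 :: nat where n2: "r' * Q * W / e / ((c - r' * Q / W) / 2) < real n2"
    using reals_Archimedean2 by blast
  have "real m0 + 1 \<le> \<delta> * real (max n1 n2)"
    using n1 \<delta>(1) by (auto simp: field_simps max_def intro: order_trans)
  from bound[OF this] have "real (max n1 n2) \<le> r' * Q * W / e / ((c - r' * Q / W) / 2)"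
    using gap by (subst pos_le_divide_eq) (simp_all only: mult.commute half_gt_zero_iff)
  then show False using n2 by simp
qed
section \<open>The Markov chain of open bins\<close>

definition template :: "int list" where
  "template = [30, 30, 30, 30, 31, 31, 58, 33, 33, 54, 37, 37, 46]"

text \<open>Only the loads in the state are tested: bins with load above 90 cannot take an item of
  size at least 30.\<close>

definition opens_bin :: "int \<Rightarrow> int list \<Rightarrow> bool" where
  "opens_bin x s \<longleftrightarrow> (\<forall>l\<in>set s. l + x > 120)"

text \<open>A state is the decreasing list of the loads at most \<open>90\<close>; fuller bins cannot receive any item.
  By the ordering, the first bin that fits is the fullest one.\<close>

fun place :: "int \<Rightarrow> int list \<Rightarrow> int list" where
  "place x [] = [x]"
| "place x (l # s) = (if l + x \<le> 120 then (l + x) # s else l # place x s)"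

text \<open>Sorting also makes the list canonical, so that equal multisets of loads give the same
  key of the table.\<close>

definition next_state :: "int \<Rightarrow> int list \<Rightarrow> int list" where
  "next_state x s = rev (sort (filter (\<lambda>l. l \<le> 90) (place x s)))"

text \<open>The reachable states with the relative value function of the chain, computed numerically by value
  iteration, multiplied by 4400 and rounded.\<close>

definition potential_table :: "(int list \<times> int) list" where
  "potential_table = [
    ([], 0), ([30], -3144), ([31], -3022), ([33], -2896), ([37], -2762), ([46], -2616),
    ([54], -2359), ([58], -2143), ([60], -1947), ([61], -1549), ([62], -1549), ([63], -1491),
    ([63,58], -3642), ([64], -1491), ([64,58], -3642), ([66], -1491), ([66,58], -3642),
    ([67], -1438), ([67,54], -3767), ([67,58], -3584), ([68], -1438), ([68,54], -3767),
    ([68,58], -3584), ([70], -1438), ([70,54], -3767), ([70,58], -3584), ([74], -1438),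
    ([74,54], -3767), ([74,58], -3584), ([76], -1387), ([76,46], -3882), ([76,54], -3684),
    ([76,58], -3518), ([77], -1387), ([77,46], -3882), ([77,54], -3684), ([77,58], -3518),
    ([79], -1387), ([79,46], -3882), ([79,54], -3684), ([79,58], -3518), ([83], -1387),
    ([83,46], -3882), ([83,54], -3684), ([83,58], -3518), ([84], -1316), ([84,37], -4099),
    ([84,46], -3886), ([84,54], -3508), ([84,58], -3374), ([84,74], -2837), ([84,74,54], -5114),
    ([84,74,58], -4970), ([84,83], -2746), ([84,83,46], -5170), ([84,83,54], -4990),
    ([84,83,58], -4867), ([85], -1316), ([85,37], -4099), ([85,46], -3886), ([85,54], -3508),
    ([85,58], -3374), ([85,74], -2837), ([85,74,54], -5114), ([85,74,58], -4970),
    ([85,83], -2746), ([85,83,46], -5170), ([85,83,54], -4990), ([85,83,58], -4867),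
    ([87], -1316), ([87,37], -4099), ([87,46], -3886), ([87,54], -3508), ([87,58], -3374),
    ([87,74], -2837), ([87,74,54], -5114), ([87,74,58], -4970), ([87,83], -2746),
    ([87,83,46], -5170), ([87,83,54], -4990), ([87,83,58], -4867), ([88], -1286),
    ([88,33], -4267), ([88,37], -4092), ([88,46], -3890), ([88,54], -3535), ([88,58], -3231),
    ([88,66], -2873), ([88,66,58], -4943), ([88,70], -2797), ([88,70,54], -5078),
    ([88,70,58], -4877), ([88,74], -2797), ([88,74,54], -5078), ([88,74,58], -4877),
    ([88,79], -2718), ([88,79,46], -5165), ([88,79,54], -4965), ([88,79,58], -4794),
    ([88,83], -2718), ([88,83,46], -5165), ([88,83,54], -4965), ([88,83,58], -4794),
    ([88,87], -2613), ([88,87,37], -5432), ([88,87,46], -5172), ([88,87,54], -4717),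
    ([88,87,58], -4609), ([88,87,74], -4194), ([88,87,74,54], -6425), ([88,87,74,58], -6302),
    ([88,87,83], -4078), ([88,87,83,46], -6467), ([88,87,83,54], -6283), ([88,87,83,58], -6184),
    ([89], -1286), ([89,33], -4267), ([89,37], -4092), ([89,46], -3890), ([89,54], -3535),
    ([89,58], -3231), ([89,66], -2873), ([89,66,58], -4943), ([89,70], -2797),
    ([89,70,54], -5078), ([89,70,58], -4877), ([89,74], -2797), ([89,74,54], -5078),
    ([89,74,58], -4877), ([89,79], -2718), ([89,79,46], -5165), ([89,79,54], -4965),
    ([89,79,58], -4794), ([89,83], -2718), ([89,83,46], -5165), ([89,83,54], -4965),
    ([89,83,58], -4794), ([89,87], -2613), ([89,87,37], -5432), ([89,87,46], -5172),
    ([89,87,54], -4717), ([89,87,58], -4609), ([89,87,74], -4194), ([89,87,74,54], -6425),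
    ([89,87,74,58], -6302), ([89,87,83], -4078), ([89,87,83,46], -6467), ([89,87,83,54], -6283),
    ([89,87,83,58], -6184), ([90], -1292), ([90,31], -4400), ([90,33], -4250), ([90,37], -4086),
    ([90,46], -3900), ([90,54], -3575), ([90,58], -3301), ([90,62], -2920), ([90,64], -2843),
    ([90,64,58], -4920), ([90,66], -2843), ([90,66,58], -4920), ([90,68], -2773),
    ([90,68,54], -5060), ([90,68,58], -4856), ([90,70], -2773), ([90,70,54], -5060),
    ([90,70,58], -4856), ([90,74], -2773), ([90,74,54], -5060), ([90,74,58], -4856),
    ([90,77], -2703), ([90,77,46], -5168), ([90,77,54], -4957), ([90,77,58], -4779),
    ([90,79], -2703), ([90,79,46], -5168), ([90,79,54], -4957), ([90,79,58], -4779),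
    ([90,83], -2703), ([90,83,46], -5168), ([90,83,54], -4957), ([90,83,58], -4779),
    ([90,85], -2611), ([90,85,37], -5425), ([90,85,46], -5173), ([90,85,54], -4733),
    ([90,85,58], -4607), ([90,85,74], -4178), ([90,85,74,54], -6415), ([90,85,74,58], -6279),
    ([90,85,83], -4067), ([90,85,83,46], -6465), ([90,85,83,54], -6277), ([90,85,83,58], -6165),
    ([90,87], -2611), ([90,87,37], -5425), ([90,87,46], -5173), ([90,87,54], -4733),
    ([90,87,58], -4607), ([90,87,74], -4178), ([90,87,74,54], -6415), ([90,87,74,58], -6279),
    ([90,87,83], -4067), ([90,87,83,46], -6465), ([90,87,83,54], -6277), ([90,87,83,58], -6165),
    ([90,89], -2576), ([90,89,33], -5603), ([90,89,37], -5408), ([90,89,46], -5178),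
    ([90,89,54], -4779), ([90,89,58], -4438), ([90,89,66], -4198), ([90,89,66,58], -6199),
    ([90,89,70], -4112), ([90,89,70,54], -6361), ([90,89,70,58], -6137), ([90,89,74], -4112),
    ([90,89,74,54], -6361), ([90,89,74,58], -6137), ([90,89,79], -4021), ([90,89,79,46], -6455),
    ([90,89,79,54], -6238), ([90,89,79,58], -6053), ([90,89,83], -4021), ([90,89,83,46], -6455),
    ([90,89,83,54], -6238), ([90,89,83,58], -6053), ([90,89,87], -3905), ([90,89,87,37], -6752),
    ([90,89,87,46], -6463), ([90,89,87,54], -5966), ([90,89,87,58], -5861),
    ([90,89,87,74], -5518), ([90,89,87,74,54], -7717), ([90,89,87,74,58], -7600),
    ([90,89,87,83], -5389), ([90,89,87,83,46], -7765), ([90,89,87,83,54], -7569),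
    ([90,89,87,83,58], -7477)]"

definition potential :: "int list \<Rightarrow> int" where
  "potential s = the (map_of potential_table s)"

text \<open>The table is scaled by 4400, so one opened bin counts 4400.\<close>

definition gain :: "int list \<Rightarrow> int \<Rightarrow> int" where
  "gain s x = potential (next_state x s) + (if opens_bin x s then 4400 else 0)"

section \<open>Finite checks on the table of states\<close>

lemma map_of_potential_table:
  "list_all (\<lambda>(s, v). map_of potential_table s = Some v) potential_table"
proof -
  have "distinct (map fst potential_table)"
    unfolding potential_table_def by simp
  then show ?thesis by (auto simp: list_all_iff)
qed

text \<open>Unfolds only the outer occurrence of the table, so that each row becomes a rewrite rule.\<close>

lemmas potential_table_lookup =
  map_of_potential_table[unfolded potential_table_def[THEN arg_cong[where f = "list_all P" for P]], simplified]

text \<open>Closure is checked by evaluating every row against the seven distinct item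
  sizes.\<close>

lemma next_state_in_table:
  assumes "s \<in> dom (map_of potential_table)" "x \<in> set template"
  shows "next_state x s \<in> dom (map_of potential_table)"
proof -
  have "list_all (\<lambda>(s, v). list_all (\<lambda>x. \<exists>u. map_of potential_table (next_state x s) = Some u)
      [30, 31, 33, 37, 46, 54, 58]) potential_table"
    by (subst potential_table_def) (simp add: potential_table_lookup next_state_def)
  then show ?thesis
    using assms map_of_SomeD[of potential_table s] by (fastforce simp: list_all_iff template_def)
qed

text \<open>The drift inequality, multiplied by 13 to stay in the integers. With 4 optimal bins per
  13 items, a ratio of 1.144 corresponds to \<open>1.144 * 4 * 4400 = 20134.4\<close>; 20135 is the
  next integer.\<close>

lemma potential_drift:
  assumes "s \<in> dom (map_of potential_table)"
  shows "13 * potential s + 20135 \<le> (\<Sum>x\<leftarrow>template. gain s x)"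
proof -
  \<comment> \<open>The coefficients are the multiplicities of the sizes in
    \<open>template\<close>.\<close>
  have "list_all (\<lambda>(s, v). 13 * v + 20135 \<le> 4 * gain s 30 + 2 * gain s 31 + 2 * gain s 33 + 2 * gain s 37 +
      gain s 46 + gain s 54 + gain s 58) potential_table"
    by (subst potential_table_def)
      (simp add: potential_table_lookup potential_def gain_def next_state_def opens_bin_def)
  then show ?thesis
    using assms map_of_SomeD[of potential_table s]
    by (fastforce simp: list_all_iff template_def potential_def)
qed

text \<open>Lets the final potential be dropped from a lower bound on the number of bins.\<close>

lemma potential_nonpos:
  assumes "s \<in> dom (map_of potential_table)"
  shows "potential s \<le> 0"
proof -
  have "list_all (\<lambda>(s, v). v \<le> 0) potential_table"
    unfolding potential_table_def by simp
  then show ?thesis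
    using assms map_of_SomeD[of potential_table s] by (fastforce simp: list_all_iff potential_def)
qed

lemma potential_Nil: "[] \<in> dom (map_of potential_table)" "potential [] = 0"
  by (simp_all add: potential_table_lookup potential_def dom_def)

section \<open>Best-Fit follows the chain\<close>

definition loads :: "int list \<Rightarrow> real multiset" where
  "loads s = image_mset (\<lambda>l. real_of_int l / 120) (mset s)"

lemma mset_place_opens: "opens_bin x s \<Longrightarrow> mset (place x s) = add_mset x (mset s)"
  by (induction s) (auto simp: opens_bin_def)

text \<open>In a decreasing list the first load that fits is the largest such load, as
  \<open>Max\<close> in \<open>best_fit_step\<close> requires.\<close>

lemma mset_place_fits:
  assumes "sorted_wrt (\<ge>) s" "\<not> opens_bin x s"
  shows "\<exists>m\<in>set s. m + x \<le> 120 \<and> (\<forall>l\<in>set s. l + x \<le> 120 \<longrightarrow> l \<le> m) \<and>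
    mset (place x s) = add_mset (m + x) (mset s - {#m#})"
  using assms
proof (induction s)
  case Nil
  then show ?case by (simp add: opens_bin_def)
next
  case (Cons l s)
  show ?case
  proof (cases "l + x \<le> 120")
    case True
    then show ?thesis using Cons.prems by (intro bexI[of _ l]) auto
  next
    case False
    then have "\<not> opens_bin x s" using Cons.prems by (auto simp: opens_bin_def)
    then obtain m where m: "m \<in> set s" "m + x \<le> 120" "\<forall>l\<in>set s. l + x \<le> 120 \<longrightarrow> l \<le> m"
      "mset (place x s) = add_mset (m + x) (mset s - {#m#})"
      using Cons by auto
    with False show ?thesis by (intro bexI[of _ m]) auto
  qed
qed

text \<open>Bins in \<open>D\<close> are loaded above 3/4 and the item has size at least
  \<open>30 / 120 = 1 / 4\<close>, so they never enter the set of fitting loads.\<close>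

lemma best_fit_step_place:
  assumes s: "sorted_wrt (\<ge>) s" and D: "\<And>d. d \<in># D \<Longrightarrow> d > 3 / 4" and x: "x \<ge> 30"
  shows "best_fit_step (real_of_int x / 120) (loads s + D) = loads (place x s) + D"
proof -
  let ?F = "{b. b \<in># loads s + D \<and> b + real_of_int x / 120 \<le> 1}"
  have F: "?F = (\<lambda>l. real_of_int l / 120) ` {l \<in> set s. l + x \<le> 120}"
    using x by (auto simp: loads_def image_iff field_simps dest!: D)
  show ?thesis
  proof (cases "opens_bin x s")
    case True
    then have "?F = {}" unfolding F by (auto simp: opens_bin_def)
    then show ?thesis
      using True by (simp add: best_fit_step_def loads_def mset_place_opens)
  next
    case False
    then obtain m where m: "m \<in> set s" "m + x \<le> 120" "\<forall>l\<in>set s. l + x \<le> 120 \<longrightarrow> l \<le> m"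
      and mset: "mset (place x s) = add_mset (m + x) (mset s - {#m#})"
      using mset_place_fits[OF s] by blast
    have "Max ?F = real_of_int m / 120"
      unfolding F using m by (intro Max_eqI) (auto simp: divide_right_mono)
    moreover have "?F \<noteq> {}" unfolding F using m by auto
    ultimately have "best_fit_step (real_of_int x / 120) (loads s + D) =
        add_mset (real_of_int m / 120 + real_of_int x / 120) (loads s + D - {#real_of_int m / 120#})"
      by (simp only: best_fit_step_def Let_def if_False)
    also have "\<dots> = loads (place x s) + D"
      using m(1) by (simp add: loads_def mset image_mset_Diff add_divide_distrib)
    finally show ?thesis .
  qed
qed

lemma size_place: "length (place x s) = length s + (if opens_bin x s then 1 else 0)"
  by (induction s) (auto simp: opens_bin_def)

lemma sorted_next_state: "sorted_wrt (\<ge>) (next_state x s)"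
  using sorted_sort by (simp add: next_state_def sorted_wrt_rev)

text \<open>The coupling of chain and algorithm: \<open>D\<close> collects the bins that the state
  has forgotten.\<close>

definition closed_extension :: "int list \<Rightarrow> real multiset \<Rightarrow> bool" where
  "closed_extension s B \<longleftrightarrow> (\<exists>D. B = loads s + D \<and> (\<forall>d\<in>#D. d > 3 / 4))"

lemma closed_extension_step:
  assumes "sorted_wrt (\<ge>) s" "closed_extension s B" "x \<ge> 30"
  shows "closed_extension (next_state x s) (best_fit_step (real_of_int x / 120) B)"
    and "size (best_fit_step (real_of_int x / 120) B) = size B + (if opens_bin x s then 1 else 0)"
proof -
  obtain D where D: "B = loads s + D" "\<forall>d\<in>#D. d > 3 / 4"
    using assms(2) by (auto simp: closed_extension_def)
  then have step: "best_fit_step (real_of_int x / 120) B = loads (place x s) + D"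
    using best_fit_step_place assms by blast
  then show "size (best_fit_step (real_of_int x / 120) B) = size B + (if opens_bin x s then 1 else 0)"
    using D by (simp add: loads_def size_place)
  \<comment> \<open>The loads removed by \<open>next_state\<close> exceed
    \<open>90 / 120 = 3 / 4\<close> and join \<open>D\<close>.\<close>
  have "mset (place x s) = mset (next_state x s) + mset (filter (\<lambda>l. \<not> l \<le> 90) (place x s))"
    by (simp add: next_state_def)
  then have "loads (place x s) = loads (next_state x s) + loads (filter (\<lambda>l. \<not> l \<le> 90) (place x s))"
    unfolding loads_def by (metis image_mset_union)
  then show "closed_extension (next_state x s) (best_fit_step (real_of_int x / 120) B)"
    unfolding closed_extension_def step using D(2)
    by (intro exI[of _ "loads (filter (\<lambda>l. \<not> l \<le> 90) (place x s)) + D"]) (auto simp: loads_def)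
qed

section \<open>Best-Fit on words over the template\<close>

definition bin_template :: "real list" where
  "bin_template = map (\<lambda>x. real_of_int x / 120) template"

definition word_state :: "nat list \<Rightarrow> int list" where
  "word_state ls = fold next_state (map ((!) template) ls) []"

definition word_bins :: "nat list \<Rightarrow> real multiset" where
  "word_bins ls = fold best_fit_step (map ((!) bin_template) ls) {#}"

lemma length_template: "length template = 13" "length bin_template = 13"
  by (simp_all add: template_def bin_template_def)

lemma template_ge: "i < 13 \<Longrightarrow> template ! i \<in> set template" "i < 13 \<Longrightarrow> template ! i \<ge> 30"
proof -
  show mem: "template ! i \<in> set template" if "i < 13" for i
    using that by (intro nth_mem) (simp add: length_template)
  have "\<forall>x\<in>set template. x \<ge> 30" by (simp add: template_def)
  then show "i < 13 \<Longrightarrow> template ! i \<ge> 30" using mem by blast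
qed

lemma bin_template_nth: "i < 13 \<Longrightarrow> bin_template ! i = real_of_int (template ! i) / 120"
  by (simp add: bin_template_def length_template)

lemma word_snoc:
  "word_state (ls @ [i]) = next_state (template ! i) (word_state ls)"
  "word_bins (ls @ [i]) = best_fit_step (bin_template ! i) (word_bins ls)"
  by (simp_all add: word_state_def word_bins_def)

text \<open>Membership in the table gives access to the drift bound; sortedness is what makes the
  coupling survive the next item.\<close>

lemma word_invariant:
  assumes "set ls \<subseteq> {..<13}"
  shows "word_state ls \<in> dom (map_of potential_table) \<and> sorted_wrt (\<ge>) (word_state ls) \<and>
    closed_extension (word_state ls) (word_bins ls)"
  using assms
proof (induction ls rule: rev_induct)
  case Nil
  have "closed_extension [] {#}" by (simp add: closed_extension_def loads_def)
  then show ?case using potential_Nil(1) by (simp add: word_state_def word_bins_def)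
next
  case (snoc i ls)
  then show ?case
    unfolding word_snoc
    by (simp add: bin_template_nth next_state_in_table template_ge sorted_next_state
        closed_extension_step(1))
qed

lemma sum_words_potential_ge:
  "13 ^ n * (20135 / 13 * real n) \<le>
     (\<Sum>ls\<in>words 13 n. 4400 * real (size (word_bins ls)) + real_of_int (potential (word_state ls)))"
proof (induction n)
  case 0
  then show ?case by (simp add: words_0 word_bins_def word_state_def potential_Nil)
next
  case (Suc n)
  \<comment> \<open>Scaled bin count plus potential: averaged over the next letter, it grows by at
    least \<open>20135 / 13\<close>.\<close>
  define \<Phi> where "\<Phi> ls = 4400 * real (size (word_bins ls)) + real_of_int (potential (word_state ls))" for ls
  have "13 * \<Phi> ls + 20135 \<le> (\<Sum>i<13. \<Phi> (ls @ [i]))" if "ls \<in> words 13 n" for ls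
  proof -
    let ?s = "word_state ls"
    have inv: "?s \<in> dom (map_of potential_table)" "sorted_wrt (\<ge>) ?s" "closed_extension ?s (word_bins ls)"
      using word_invariant[of ls] that by (simp_all add: words_def)
    have "\<Phi> (ls @ [i]) = 4400 * real (size (word_bins ls)) + real_of_int (gain ?s (template ! i))"
      if "i < 13" for i
      using closed_extension_step(2)[OF inv(2,3) template_ge(2)[OF that]] that
      by (simp add: \<Phi>_def word_snoc bin_template_nth gain_def)
    then have "(\<Sum>i<13. \<Phi> (ls @ [i])) =
        13 * (4400 * real (size (word_bins ls))) + real_of_int (\<Sum>i<13. gain ?s (template ! i))"
      by (simp add: sum.distrib)
    also have "(\<Sum>i<13. gain ?s (template ! i)) = (\<Sum>x\<leftarrow>template. gain ?s x)"
      by (simp add: sum_list_sum_nth atLeast0LessThan length_template)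
    finally show ?thesis
      using potential_drift[OF inv(1)] by (simp add: \<Phi>_def)
  qed
  then have "(\<Sum>ls\<in>words 13 n. 13 * \<Phi> ls + 20135) \<le> (\<Sum>ls\<in>words 13 (Suc n). \<Phi> ls)"
    unfolding sum_words_Suc by (rule sum_mono)
  moreover have "(\<Sum>ls\<in>words 13 n. 13 * \<Phi> ls + 20135) = 13 * (\<Sum>ls\<in>words 13 n. \<Phi> ls) + 13 ^ n * 20135"
    by (simp add: sum.distrib sum_distrib_left card_words)
  ultimately show ?case
    using Suc.IH by (simp add: \<Phi>_def algebra_simps)
qed

text \<open>Here \<open>57200 = 13 * 4400\<close> converts the drift into opened bins per
  item.\<close>

lemma sum_words_best_fit_ge:
  "13 ^ n * (20135 / 57200 * real n) \<le> (\<Sum>ls\<in>words 13 n. real (best_fit (map ((!) bin_template) ls)))"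
proof -
  have "13 ^ n * (20135 / 13 * real n) \<le>
      (\<Sum>ls\<in>words 13 n. 4400 * real (size (word_bins ls)) + real_of_int (potential (word_state ls)))"
    by (rule sum_words_potential_ge)
  also have "\<dots> \<le> (\<Sum>ls\<in>words 13 n. 4400 * real (size (word_bins ls)))"
  proof (rule sum_mono)
    fix ls assume "ls \<in> words 13 n"
    then have "potential (word_state ls) \<le> 0"
      using word_invariant[of ls] potential_nonpos by (simp add: words_def)
    then show "4400 * real (size (word_bins ls)) + real_of_int (potential (word_state ls)) \<le>
      4400 * real (size (word_bins ls))" by simp
  qed
  also have "\<dots> = 4400 * (\<Sum>ls\<in>words 13 n. real (best_fit (map ((!) bin_template) ls)))"
    by (simp add: sum_distrib_left best_fit_def word_bins_def)
  finally show ?thesis by (simp add: mult_ac)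
qed

text \<open>The template lists the bins consecutively: the four items of size 30, then three
  triples, each of total 120.\<close>

lemma bin_template_packing:
  "is_packing bin_template 4 (\<lambda>i. if i < 4 then 0 else Suc ((i - 4) div 3))"
proof -
  let ?g = "\<lambda>i::nat. if i < 4 then 0 else Suc ((i - 4) div 3)"
  have "(\<Sum>i | i < 13 \<and> ?g i = b. bin_template ! i) = (\<Sum>i<13. if ?g i = b then bin_template ! i else 0)" for b
    by (simp add: sum.inter_filter[symmetric])
  moreover have "(\<Sum>i<13. if ?g i = b then bin_template ! i else 0) \<le> 1" if "b < 4" for b
  proof -
    have "b \<in> {0, 1, 2, 3}" using that by auto
    then show ?thesis
      by (elim insertE emptyE)
        (simp_all add: lessThan_nat_numeral bin_template_def template_def del: sum.lessThan_Suc)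
  qed
  ultimately show ?thesis
    unfolding is_packing_def length_template by auto
qed

theorem theorem1p2:
  shows "random_order_ratio best_fit > ereal 1.144"
proof (rule random_order_ratio_gt_template[OF _ _ bin_template_packing])
  show "bp_instance bin_template" by (simp add: bp_instance_def bin_template_def template_def)
  show "bin_template \<noteq> []" using length_template by auto
  show "real (length bin_template) ^ n * (20135 / 57200 * real n) \<le>
      (\<Sum>ls\<in>words (length bin_template) n. real (best_fit (map ((!) bin_template) ls)))" for n
    unfolding length_template using sum_words_best_fit_ge by simp
  \<comment> \<open>The right-hand side is \<open>20135 / 17600\<close>, about 1.14403.\<close>
  show "1.144 < 20135 / 57200 * real (length bin_template) / real (4::nat)"
    by (simp add: length_template)
qed simp_all

end
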